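(* As $n\to\infty$ through the positive integers, the number of prime numbers in the interval $[8n,9n]$ goes to infinity. That is, for every positive integer $m$ there exists a positive integer $L$ such that for all integers $n\geq L$ there are at least $m$ prime numbers in the interval $[8n,9n]$. *)

theory Defs
  imports Complex_Main "HOL-Computational_Algebra.Primes"
begin

end

theory Submission
  imports Defs "HOL-Number_Theory.Prime_Powers" "HOL-Real_Asymp.Real_Asymp"
begin

text \<open>
  The argument is Chebyshev's. Since ln (N!) is the sum of \<Lambda>(k) \<lfloor>N/k\<rfloor>, a combination of the
  numbers ln (\<lfloor>qn\<rfloor>!) with coefficients c(q) equals the sum of \<Lambda>(k) G(n/k), where G(z) is the sum of
  c(q) \<lfloor>qz\<rfloor>. If the sum of c(q) q vanishes, then by Stirling this combination is asymptotic to A n,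
  where A is the sum of c(q) q ln q.

  We use 23 fractions q of the form 9/d and 8/d with coefficients 1 and -1, such that G is at most 1
  for z in [1/9, 1/8), at most 0 for other z < 35, at most 1 for z < 120, and at most 10 throughout.
  Hence \<psi>(9n) - \<psi>(8n) is at least the combination minus \<psi>(n/35) + 9 \<psi>(n/120). As \<psi>(x) is at
  most x ln 4, this is at least a positive multiple of n, because A exceeds (1/35 + 9/120) ln 4.
  Proper prime powers contribute too little to matter.
\<close>

subsection \<open>The Chebyshev function\<close>

definition chebyshev_psi :: "nat \<Rightarrow> real" where
  "chebyshev_psi n = (\<Sum>k = 1..n. mangoldt k)"

text \<open>Indicator form: values of psi at several arguments become sums over one common
  range.\<close>

lemma chebyshev_psi_restrict:
  assumes "m \<le> n"
  shows "(\<Sum>k = 1..n. mangoldt k * of_bool (k \<le> m)) = chebyshev_psi m"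
proof -
  have "(\<Sum>k = 1..n. mangoldt k * of_bool (k \<le> m)) = (\<Sum>k \<in> {1..m}. mangoldt k :: real)"
    using assms by (intro sum.mono_neutral_cong_right) auto
  thus ?thesis by (simp add: chebyshev_psi_def)
qed

text \<open>Passing from n to n + 1 raises \<open>n div k\<close> exactly for the divisors k of n +
  1, whose \<Lambda>-values sum to ln (n + 1). The upper limit \<open>m\<close> is free so that
  identities for different \<open>n\<close> can be combined.\<close>

lemma ln_fact_eq_sum_mangoldt:
  assumes "n \<le> m"
  shows "ln (fact n :: real) = (\<Sum>k = 1..m. mangoldt k * real (n div k))"
  using assms
proof (induction n)
  case (Suc n)
  have eq: "{k \<in> {1..m}. k dvd Suc n} = {k. k dvd Suc n}"
    using Suc.prems by (auto dest: dvd_imp_le simp: Suc_le_eq intro!: Nat.gr0I)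
  have "(\<Sum>k = 1..m. mangoldt k * real (Suc n div k))
      = (\<Sum>k = 1..m. mangoldt k * real (n div k) + (if k dvd Suc n then mangoldt k else 0))"
    by (intro sum.cong) (auto simp: div_Suc dvd_eq_mod_eq_0 algebra_simps)
  also have "\<dots> = ln (fact n) + (\<Sum>k | k dvd Suc n. mangoldt k)"
    unfolding eq[symmetric] sum.distrib using Suc by (subst sum.inter_filter) auto
  also have "\<dots> = ln (fact (Suc n))"
    by (subst mangoldt_sum) (auto simp: ln_mult add_ac simp del: of_nat_Suc)
  finally show ?case by simp
qed auto

text \<open>In the \<Lambda>-expansion of the log binomial, every coefficient is nonnegative. For a
  < k \<le> a + b it is at least 1, since b \<le> a makes both subtracted floors vanish.\<close>

lemma chebyshev_psi_diff_le:
  fixes a b :: nat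
  assumes "b \<le> a"
  shows "chebyshev_psi (a + b) - chebyshev_psi a \<le> ln ((a + b) choose b)"
proof -
  have "fact (a + b) = fact a * fact b * (real ((a + b) choose b))"
    using binomial_fact[of b "a + b", where 'a = real] by simp
  moreover have "real ((a + b) choose b) > 0" by simp
  ultimately have "ln (real ((a + b) choose b)) = ln (fact (a + b)) - ln (fact a) - ln (fact b)"
    by (simp add: ln_mult)
  also have "\<dots> = (\<Sum>k = 1..a+b. mangoldt k * (real ((a + b) div k) - real (a div k) - real (b div k)))"
    by (simp add: ln_fact_eq_sum_mangoldt[of _ "a + b"] ring_distribs sum_subtractf)
  also have "\<dots> \<ge> (\<Sum>k = 1..a+b. mangoldt k * (1 - of_bool (k \<le> a)))"
  proof (intro sum_mono mult_left_mono mangoldt_nonneg)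
    fix k assume k: "k \<in> {1..a + b}"
    have 1: "a div k + b div k \<le> (a + b) div k"
      by (metis div_add1_eq le_add1)
    show "1 - of_bool (k \<le> a) \<le> real ((a + b) div k) - real (a div k) - real (b div k)"
    proof (cases "k \<le> a")
      case True
      thus ?thesis using 1 by simp
    next
      case False
      hence "a div k = 0" "b div k = 0" using assms by auto
      moreover have "(a + b) div k \<ge> 1"
        using k by (simp add: Suc_le_eq div_greater_zero_iff)
      ultimately show ?thesis using False by simp
    qed
  qed
  also have "(\<Sum>k = 1..a+b. mangoldt k * (1 - of_bool (k \<le> a))) = chebyshev_psi (a + b) - chebyshev_psi a"
    by (simp only: right_diff_distrib sum_subtractf chebyshev_psi_restrict[OF le_add1])
       (simp add: chebyshev_psi_def)
  finally show ?thesis .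
qed

text \<open>The two middle entries of row 2m + 1 are equal, and the row sums to 2 * 4^m.\<close>

lemma binomial_odd_central_le: "(2 * m + 1) choose m \<le> 4 ^ m"
proof -
  have "2 * ((2 * m + 1) choose m) = (\<Sum>k\<in>{m, m + 1}. (2 * m + 1) choose k)"
    using binomial_symmetric[of m "2 * m + 1"] by simp
  also have "\<dots> \<le> (\<Sum>k\<le>2 * m + 1. (2 * m + 1) choose k)"
    by (intro sum_mono2) auto
  also have "\<dots> = 2 * 4 ^ m"
    by (simp only: choose_row_sum) (simp add: power_mult)
  finally show ?thesis by simp
qed

text \<open>Strong induction by halving: with n = m + m or n = (m + 1) + m, the second summand adds
  at most the log of a binomial coefficient bounded by 4^m.\<close>

lemma chebyshev_psi_le: "chebyshev_psi n \<le> real n * ln 4"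
proof (induction n rule: less_induct)
  case (less n)
  have "n = 2 * (n div 2) \<or> n = 2 * (n div 2) + 1" by linarith
  then consider "n = 0" | "n = 1" | m where "n = 2 * m" "m > 0" | m where "n = 2 * m + 1" "m > 0"
    by (cases "n div 2 = 0") auto
  thus ?case
  proof cases
    case 3
    have "real ((m + m) choose m) \<le> 4 ^ m"
    proof -
      have "(m + m) choose m \<le> (\<Sum>k\<le>m + m. (m + m) choose k)"
        by (intro member_le_sum) auto
      also have "\<dots> = 4 ^ m" by (simp only: choose_row_sum) (simp add: power_add flip: power_mult_distrib)
      finally show ?thesis by (metis of_nat_le_iff of_nat_numeral of_nat_power)
    qed
    hence "ln ((m + m) choose m) \<le> real m * ln 4"
      by (subst ln_realpow[symmetric]) (auto simp: zero_less_binomial_iff)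
    moreover have "n = m + m" using 3 by simp
    moreover from this have "chebyshev_psi m \<le> real m * ln 4" using 3 by (intro less.IH) simp
    ultimately show ?thesis
      using chebyshev_psi_diff_le[of m m] by (simp add: distrib_right)
  next
    case 4
    have "((m + 1) + m) choose m \<le> 4 ^ m"
      using binomial_odd_central_le[of m] by (simp add: mult_2)
    hence "real (((m + 1) + m) choose m) \<le> 4 ^ m"
      by (metis of_nat_le_iff of_nat_numeral of_nat_power)
    hence "ln (((m + 1) + m) choose m) \<le> real m * ln 4"
      by (subst ln_realpow[symmetric]) (auto simp: zero_less_binomial_iff)
    moreover have "n = (m + 1) + m" using 4 by simp
    moreover from this have "chebyshev_psi (m + 1) \<le> real (m + 1) * ln 4" using 4 by (intro less.IH) simp
    ultimately show ?thesis
      using chebyshev_psi_diff_le[of m "m + 1"] by (simp add: distrib_right)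
  qed (auto simp: chebyshev_psi_def)
qed

lemma chebyshev_psi_div_le: "chebyshev_psi (n div m) \<le> real n / real m * ln 4"
proof -
  have "chebyshev_psi (n div m) \<le> real (n div m) * ln 4" by (rule chebyshev_psi_le)
  also have "\<dots> \<le> real n / real m * ln 4"
    by (intro mult_right_mono of_nat_div_le_of_nat) auto
  finally show ?thesis .
qed

section \<open>From psi to counting primes\<close>

lemma card_nonprime_primepows_le:
  fixes x :: nat
  assumes "x \<ge> 1"
  shows "real (card {k. primepow k \<and> \<not>prime k \<and> k \<le> x}) \<le> (sqrt x + 1) * (log 2 x + 1)"
proof -
  \<comment> \<open>A proper prime power p^j \<le> x has j \<ge> 2, hence p \<le> sqrt x, and 2^j
    \<le> x, hence j \<le> log 2 x. Both ranges include 0, whence the two summands 1 in the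
    bound.\<close>
  define S where "S = {..nat \<lfloor>sqrt x\<rfloor>} \<times> {..nat \<lfloor>log 2 x\<rfloor>}"
  have "{k. primepow k \<and> \<not>prime k \<and> k \<le> x} \<subseteq> (\<lambda>(p, j). p ^ j) ` S"
  proof safe
    fix k :: nat assume k: "primepow k" "\<not>prime k" "k \<le> x"
    then obtain p j where pj: "prime p" "j > 0" "k = p ^ j" by (auto simp: primepow_def)
    with k have "j \<ge> 2" by (cases "j = 1") auto
    have p: "p \<ge> 2" using pj(1) by (rule prime_ge_2_nat)
    have "p ^ 2 \<le> k" using power_increasing[OF \<open>j \<ge> 2\<close>, of p] p pj(3) by simp
    hence "real p ^ 2 \<le> real k" by (metis of_nat_le_iff of_nat_power)
    hence "real p \<le> sqrt x" using k(3) by (intro real_le_rsqrt) auto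
    moreover have "2 ^ j \<le> k" using power_mono[of 2 p j] p pj(3) by simp
    hence "2 ^ j \<le> x" using k(3) by linarith
    hence "real j \<le> log 2 x" using le_log2_of_power by blast
    ultimately have "(p, j) \<in> S" by (auto simp: S_def le_nat_floor)
    thus "k \<in> (\<lambda>(p, j). p ^ j) ` S" using pj(3) by force
  qed
  hence "card {k. primepow k \<and> \<not>prime k \<and> k \<le> x} \<le> card S"
    by (rule surj_card_le[rotated]) (auto simp: S_def)
  also have "real (card S) = (real (nat \<lfloor>sqrt x\<rfloor>) + 1) * (real (nat \<lfloor>log 2 x\<rfloor>) + 1)"
    by (simp add: S_def algebra_simps del: of_nat_nat)
  also have "\<dots> \<le> (sqrt x + 1) * (log 2 x + 1)"
    using assms by (intro mult_mono add_right_mono of_nat_floor) auto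
  finally show ?thesis by simp
qed

text \<open>Each prime power in (m, n] contributes at most ln n; it is either a prime or one of the
  few proper prime powers.\<close>

lemma chebyshev_psi_diff_le_card_primes:
  assumes "0 < m" "m \<le> n"
  shows "chebyshev_psi n - chebyshev_psi m
           \<le> (real (card {p. prime p \<and> p \<in> {m..n}}) + (sqrt n + 1) * (log 2 n + 1)) * ln n"
proof -
  define P Q where "P = {p. prime p \<and> p \<in> {m..n}}" and "Q = {k. primepow k \<and> \<not>prime k \<and> k \<le> n}"
  have [simp]: "finite P" "finite Q"
    by (auto simp: P_def Q_def intro: finite_subset[of _ "{..n}"])
  have "{1..n} = {1..m} \<union> {m<..n}" using assms by auto
  moreover have "sum mangoldt ({1..m} \<union> {m<..n}) = sum mangoldt {1..m} + (\<Sum>k\<in>{m<..n}. mangoldt k :: real)"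
    by (rule sum.union_disjoint) auto
  ultimately have "chebyshev_psi n - chebyshev_psi m = (\<Sum>k\<in>{m<..n}. mangoldt k)"
    by (simp add: chebyshev_psi_def)
  also have "\<dots> = (\<Sum>k\<in>{k\<in>{m<..n}. primepow k}. mangoldt k)"
    by (intro sum.mono_neutral_right) (auto simp: mangoldt_def)
  also have "\<dots> \<le> real (card {k\<in>{m<..n}. primepow k}) * ln n"
  proof (rule sum_bounded_above)
    fix k assume "k \<in> {k\<in>{m<..n}. primepow k}"
    hence "k > 0" "k \<le> n" by auto
    from \<open>k > 0\<close> have "mangoldt k \<le> ln (real k)" by (rule mangoldt_le)
    also have "\<dots> \<le> ln (real n)" using \<open>k > 0\<close> \<open>k \<le> n\<close> by simp
    finally show "mangoldt k \<le> ln (real n)" .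
  qed
  also have "card {k\<in>{m<..n}. primepow k} \<le> card (P \<union> Q)"
    by (intro card_mono) (auto simp: P_def Q_def)
  also have "\<dots> \<le> card P + card Q" by (rule card_Un_le)
  also have "real (card P + card Q) \<le> real (card P) + (sqrt n + 1) * (log 2 n + 1)"
    using card_nonprime_primepows_le[of n] assms by (simp add: Q_def)
  finally show ?thesis
    using assms by (simp add: P_def mult_right_mono)
qed

subsection \<open>Asymptotics of factorials\<close>

text \<open>Induction: the inequality ln y \<le> y - 1 at y = (x + 1)/x and at y = x/(x + 1)
  compares the increments of both bounds with ln (x + 1).\<close>

lemma ln_fact_bounds:
  assumes "n \<ge> 1"
  shows "real n * ln n - n \<le> ln (fact n)"
    and "ln (fact n) \<le> real n * ln n - n + ln n + 1"
proof -
  have "real n * ln n - n \<le> ln (fact n) \<and> ln (fact n) \<le> real n * ln n - n + ln n + 1"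
    using assms
  proof (induction n rule: dec_induct)
    case (step n)
    define x where "x = real n"
    have x: "x > 0" using step.hyps by (simp add: x_def)
    have "ln ((x + 1) / x) \<le> (x + 1) / x - 1" using x by (intro ln_le_minus_one) auto
    hence 1: "x * (ln (x + 1) - ln x) \<le> 1"
      using x by (simp add: ln_div field_simps)
    have "ln (x / (x + 1)) \<le> x / (x + 1) - 1" using x by (intro ln_le_minus_one) auto
    hence 2: "(x + 1) * (ln (x + 1) - ln x) \<ge> 1"
      using x by (simp add: ln_div field_simps)
    have 3: "ln (fact (Suc n)) = ln (fact n) + ln (x + 1)"
      by (simp add: x_def ln_mult add_ac)
    have 4: "real (Suc n) = x + 1" by (simp add: x_def)
    show ?case using step.IH 1 2 unfolding 3 4 x_def[symmetric]
      by (simp add: algebra_simps)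
  qed auto
  thus "real n * ln n - n \<le> ln (fact n)" "ln (fact n) \<le> real n * ln n - n + ln n + 1"
    by auto
qed

text \<open>Stirling at \<lfloor>qn\<rfloor>. The subtracted term is linear in q, so it cancels in a
  balanced combination and only q ln q survives.\<close>

lemma ln_fact_div_asymp:
  assumes "a > 0" "d > 0"
  defines "q \<equiv> real a / real d"
  shows "(\<lambda>n. ln (fact (a * n div d)) / real n - q * (ln n - 1)) \<longlonglongrightarrow> q * ln q"
proof -
  define N where "N = (\<lambda>n. a * n div d)"
  have q: "q > 0" using assms by simp
  have N_le: "real (N n) \<le> q * n" for n
    using of_nat_div_le_of_nat[of "a * n" d] by (simp add: N_def q_def)
  have N_ge: "real (N n) \<ge> q * n - 1" for n
  proof -
    have "real (N n) = of_int \<lfloor>q * n\<rfloor>"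
      using floor_divide_of_nat_eq[of "a * n" d, where 'a = real] by (simp add: N_def q_def)
    thus ?thesis by linarith
  qed
  have "filterlim (\<lambda>n. q * real n - 1) at_top sequentially"
    using q by real_asymp
  hence "filterlim (\<lambda>n. real (N n)) at_top sequentially"
    by (rule filterlim_at_top_mono) (use N_ge in auto)
  hence N: "filterlim N at_top sequentially"
    by (simp add: filterlim_sequentially_iff_filterlim_real)
  have "(\<lambda>n. ln (fact n) / real n - ln n + 1) \<longlonglongrightarrow> 0"
  proof (rule tendsto_sandwich)
    show "\<forall>\<^sub>F n in sequentially. 0 \<le> ln (fact n) / real n - ln (real n) + 1"
      using eventually_ge_at_top[of 1]
      by eventually_elim (use ln_fact_bounds(1) in \<open>auto simp: field_simps\<close>)
    show "\<forall>\<^sub>F n in sequentially. ln (fact n) / real n - ln (real n) + 1 \<le> (ln (real n) + 1) / real n"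
      using eventually_ge_at_top[of 1]
    proof eventually_elim
      case (elim n)
      have "ln (fact n) / real n \<le> (real n * ln n - n + ln n + 1) / n"
        using ln_fact_bounds(2)[OF elim] by (rule divide_right_mono) auto
      also have "\<dots> = ln n - 1 + (ln n + 1) / n" using elim by (simp add: field_simps)
      finally show ?case by simp
    qed
    show "(\<lambda>n. (ln (real n) + 1) / real n) \<longlonglongrightarrow> 0" by real_asymp
  qed auto
  hence lim1: "(\<lambda>n. ln (fact (N n)) / real (N n) - ln (N n) + 1) \<longlonglongrightarrow> 0"
    using N by (rule filterlim_compose)
  have lim2: "(\<lambda>n. real (N n) / n) \<longlonglongrightarrow> q"
  proof (rule tendsto_sandwich)
    show "\<forall>\<^sub>F n in sequentially. q - 1 / real n \<le> real (N n) / n"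
      using eventually_gt_at_top[of 0]
    proof eventually_elim
      case (elim n)
      have "(q * n - 1) / n \<le> real (N n) / n" using N_ge by (rule divide_right_mono) auto
      thus ?case using elim by (simp add: field_simps)
    qed
    show "\<forall>\<^sub>F n in sequentially. real (N n) / n \<le> q"
      using eventually_gt_at_top[of 0]
      by eventually_elim (use N_le in \<open>auto simp: field_simps\<close>)
    show "(\<lambda>n. q - 1 / real n) \<longlonglongrightarrow> q" by real_asymp
  qed auto
  \<comment> \<open>Convergence of N/n to q alone would not suffice against the factor ln n; the
    error is at most 1/n because N is within 1 of qn.\<close>
  have lim3: "(\<lambda>n. (real (N n) / n - q) * ln n) \<longlonglongrightarrow> 0"
  proof (rule tendsto_sandwich)
    have "(q * real n - real (N n)) * ln n \<le> 1 * ln n" if "n > 0" for n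
      using that N_ge[of n] by (intro mult_right_mono) (auto simp: algebra_simps)
    thus "\<forall>\<^sub>F n in sequentially. - (ln (real n) / n) \<le> (real (N n) / n - q) * ln n"
      by (intro eventually_mono[OF eventually_gt_at_top[of 0]]) (force simp: field_simps)
    have "(q * real n - real (N n)) * ln n \<ge> 0" if "n > 0" for n
      using that N_le[of n] by (intro mult_nonneg_nonneg) auto
    thus "\<forall>\<^sub>F n in sequentially. (real (N n) / n - q) * ln n \<le> 0"
      by (intro eventually_mono[OF eventually_gt_at_top[of 0]]) (force simp: field_simps)
    show "(\<lambda>n. - (ln (real n) / real n)) \<longlonglongrightarrow> 0" by real_asymp
  qed auto
  have "(\<lambda>n. real (N n) / n * (ln (fact (N n)) / real (N n) - ln (N n) + 1)
           + real (N n) / n * ln (real (N n) / n) - (real (N n) / n - q)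
           + (real (N n) / n - q) * ln n) \<longlonglongrightarrow> q * 0 + q * ln q - (q - q) + 0"
    using q by (intro tendsto_intros lim1 lim2 lim3) auto
  also have "?this \<longleftrightarrow> (\<lambda>n. ln (fact (N n)) / real n - q * (ln n - 1)) \<longlonglongrightarrow> q * 0 + q * ln q - (q - q) + 0"
  proof (rule tendsto_cong)
    show "\<forall>\<^sub>F n in sequentially. real (N n) / n * (ln (fact (N n)) / real (N n) - ln (N n) + 1)
           + real (N n) / n * ln (real (N n) / n) - (real (N n) / n - q)
           + (real (N n) / n - q) * ln n = ln (fact (N n)) / real n - q * (ln n - 1)"
      using eventually_gt_at_top[of 0] eventually_compose_filterlim[OF eventually_gt_at_top[of 0] N]
      by eventually_elim (simp add: ln_div field_simps)
  qed
  finally show ?thesis by (simp add: N_def)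
qed

section \<open>Integer combinations of log factorials\<close>

definition floor_comb :: "(int \<times> nat) list \<Rightarrow> nat \<Rightarrow> int" where
  "floor_comb cs s = (\<Sum>(c, d)\<leftarrow>cs. c * int (s div d))"

definition ln_fact_comb :: "(int \<times> nat) list \<Rightarrow> nat \<Rightarrow> real" where
  "ln_fact_comb cs n = (\<Sum>(c, d)\<leftarrow>cs. of_int c * ln (fact (n div d)))"

text \<open>Nested floor divisions commute, so the coefficient of \<Lambda>(k) depends only on
  \<open>n div k\<close>.\<close>

lemma ln_fact_comb_eq_sum_mangoldt:
  assumes "n \<le> m"
  shows "ln_fact_comb cs n = (\<Sum>k = 1..m. mangoldt k * of_int (floor_comb cs (n div k)))"
proof (induction cs)
  case (Cons cd cs)
  obtain c d where cd: "cd = (c, d)" by (cases cd)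
  have "n div d \<le> m" using assms div_le_dividend le_trans by blast
  hence "ln (fact (n div d)) = (\<Sum>k = 1..m. mangoldt k * real (n div d div k))"
    by (rule ln_fact_eq_sum_mangoldt)
  hence "ln (fact (n div d)) = (\<Sum>k = 1..m. mangoldt k * real (n div k div d))"
    by (simp add: mult.commute flip: div_mult2_eq)
  with Cons.IH show ?case
    by (simp add: cd ln_fact_comb_def floor_comb_def sum_distrib_left distrib_left mult_ac flip: sum.distrib)
qed (auto simp: ln_fact_comb_def floor_comb_def)

lemma ln_fact_comb_asymp:
  assumes "a > 0" and "\<forall>(c, d) \<in> set cs. d > 0"
  shows "(\<lambda>n. ln_fact_comb cs (a * n) / n - (\<Sum>(c, d)\<leftarrow>cs. of_int c / real d) * a * (ln n - 1))
           \<longlonglongrightarrow> (\<Sum>(c, d)\<leftarrow>cs. of_int c * (a / d * ln (a / d)))"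
  using assms(2)
proof (induction cs)
  case (Cons cd cs)
  obtain c d where cd: "cd = (c, d)" by (cases cd)
  from Cons.prems have "d > 0" by (simp add: cd)
  from tendsto_add[OF tendsto_mult_left[OF ln_fact_div_asymp[OF assms(1) this], of "of_int c"] Cons.IH]
  show ?case using Cons.prems
    by (simp add: cd ln_fact_comb_def algebra_simps add_divide_distrib)
qed (auto simp: ln_fact_comb_def)

subsection \<open>Bounding combinations of floors\<close>

text \<open>From x - 1 \<le> \<lfloor>x\<rfloor> \<le> x, replacing a floor by its argument costs
  nothing for a nonnegative coefficient c and at most -c for a negative one.\<close>

lemma floor_comb_div_le:
  assumes "k > 0" and "\<forall>(c, d) \<in> set cs. d > 0"
  shows "real_of_int (floor_comb cs (n div k))
           \<le> (\<Sum>(c, d)\<leftarrow>cs. of_int c / real d) * (n / k) + (\<Sum>(c, d)\<leftarrow>cs. max 0 (- of_int c))"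
  using assms(2)
proof (induction cs)
  case (Cons cd cs)
  obtain c d where cd: "cd = (c, d)" by (cases cd)
  define y where "y = real (n div k div d)"
  define x where "x = real n / (real k * real d)"
  have "y = of_int \<lfloor>x\<rfloor>"
    using floor_divide_of_nat_eq[of n "k * d", where 'a = real]
    by (simp add: x_def y_def div_mult2_eq)
  hence y: "y \<le> x" "x - 1 \<le> y" by linarith+
  have "of_int c * y \<le> of_int c * x + max 0 (- of_int c)"
  proof (cases "c \<ge> 0")
    case True
    thus ?thesis using mult_left_mono[OF y(1), of "of_int c"] by simp
  next
    case False
    thus ?thesis using mult_left_mono[OF y(2), of "- of_int c"] by (simp add: algebra_simps)
  qed
  with Cons show ?case by (simp add: floor_comb_def cd x_def y_def algebra_simps)
qed (auto simp: floor_comb_def)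

text \<open>
  The bounds on \<open>floor_comb\<close> are verified by stepping its argument upwards with a counter for every
  divisor, because division of numerals is expensive for the simplifier. A counter is a triple of a
  coefficient, a divisor, and the distance to the next multiple of the divisor.
\<close>

fun advance :: "(int \<times> int \<times> int) list \<Rightarrow> (int \<times> int \<times> int) list" where
  "advance [] = []"
| "advance ((c, d, r) # xs) = (c, d, if r = 1 then d else r - 1) # advance xs"

fun jump :: "(int \<times> int \<times> int) list \<Rightarrow> int" where
  "jump [] = 0"
| "jump ((c, d, r) # xs) = (if r = 1 then c + jump xs else jump xs)"

text \<open>The distance lies in 1..d and equals d at a multiple of d, so the value 1 signals that
  the next increment reaches a multiple.\<close>

definition counters :: "(int \<times> nat) list \<Rightarrow> nat \<Rightarrow> (int \<times> int \<times> int) list" where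
  "counters cs s = map (\<lambda>(c, d). (c, int d, int d - int (s mod d))) cs"

lemma counter_step:
  fixes d s :: nat
  assumes "d > 0"
  shows "int d - int (Suc s mod d) = (if int d - int (s mod d) = 1 then int d else int d - int (s mod d) - 1)"
    and "int (Suc s div d) = int (s div d) + (if int d - int (s mod d) = 1 then 1 else 0)"
proof -
  have "s mod d < d" using assms by simp
  hence "int d - int (s mod d) = 1 \<longleftrightarrow> Suc (s mod d) = d" by linarith
  thus "int d - int (Suc s mod d) = (if int d - int (s mod d) = 1 then int d else int d - int (s mod d) - 1)"
    and "int (Suc s div d) = int (s div d) + (if int d - int (s mod d) = 1 then 1 else 0)"
    by (auto simp: mod_Suc div_Suc)
qed

lemma advance_counters:
  "\<forall>(c, d) \<in> set cs. d > 0 \<Longrightarrow> advance (counters cs s) = counters cs (Suc s)"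
  by (induction cs) (auto simp: counters_def counter_step(1) simp del: of_nat_Suc)

lemma jump_counters:
  "\<forall>(c, d) \<in> set cs. d > 0 \<Longrightarrow> jump (counters cs s) = floor_comb cs (Suc s) - floor_comb cs s"
  by (induction cs) (auto simp: counters_def floor_comb_def counter_step(2) algebra_simps)

text \<open>
  A path is a list of steps that increment either the first argument (\<open>left\<close>) or the second one; the
  bound is checked only after steps flagged \<open>test\<close>.
\<close>

fun walk where
  "walk b [] xs ys v = Some (v, xs, ys)"
| "walk b ((left, test) # ps) xs ys v =
    (if left then
       (if test \<and> v + jump xs > b then None else walk b ps (advance xs) ys (v + jump xs))
     else
       (if test \<and> v + jump ys > b then None else walk b ps xs (advance ys) (v + jump ys)))"

text \<open>The property certified by a successful \<open>walk\<close>. The starting pair is not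
  tested, so its bound is a separate hypothesis below.\<close>

fun bounded_on_path where
  "bounded_on_path b f [] s t = True"
| "bounded_on_path b f ((left, test) # ps) s t =
    (let s' = (if left then Suc s else s); t' = (if left then t else Suc t)
     in (test \<longrightarrow> f s' t' \<le> b) \<and> bounded_on_path b f ps s' t')"

text \<open>Soundness of the simulation, by induction along the path. The final state is included so
  that walks can be chained.\<close>

lemma walk_counters:
  assumes pos: "\<forall>(c, d) \<in> set cs. d > 0" "\<forall>(c, d) \<in> set ds. d > 0"
    and "walk b ps (counters cs s) (counters ds t) (floor_comb cs s + floor_comb ds t) = Some (v, xs, ys)"
  defines "s' \<equiv> s + length (filter fst ps)" and "t' \<equiv> t + length (filter (\<lambda>p. \<not>fst p) ps)"
  shows "bounded_on_path b (\<lambda>s t. floor_comb cs s + floor_comb ds t) ps s t \<and>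
    v = floor_comb cs s' + floor_comb ds t' \<and> xs = counters cs s' \<and> ys = counters ds t'"
  using assms(3) unfolding s'_def t'_def
proof (induction ps arbitrary: s t)
  case (Cons p ps)
  obtain left test where p: "p = (left, test)" by (cases p)
  show ?case
  proof (cases left)
    case True
    have "walk b ps (counters cs (Suc s)) (counters ds t) (floor_comb cs (Suc s) + floor_comb ds t) = Some (v, xs, ys)"
      and "test \<Longrightarrow> floor_comb cs (Suc s) + floor_comb ds t \<le> b"
      using Cons.prems by (auto simp: p True advance_counters jump_counters pos algebra_simps split: if_splits)
    with Cons.IH[of "Suc s" t] show ?thesis by (simp add: p True)
  next
    case False
    have "walk b ps (counters cs s) (counters ds (Suc t)) (floor_comb cs s + floor_comb ds (Suc t)) = Some (v, xs, ys)"
      and "test \<Longrightarrow> floor_comb cs s + floor_comb ds (Suc t) \<le> b"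
      using Cons.prems by (auto simp: p False advance_counters jump_counters pos algebra_simps split: if_splits)
    with Cons.IH[of s "Suc t"] show ?thesis by (simp add: p False)
  qed
qed auto

text \<open>
  The values of (\<lfloor>9z\<rfloor>, \<lfloor>8z\<rfloor>) as z runs through an interval [m, m + 1]. Both components jump at
  m + 1, so the intermediate pair after the last increment of the first component is not attained.
\<close>

definition unit_path :: "(bool \<times> bool) list" where
  "unit_path =
    [(True, True), (False, True), (True, True), (False, True), (True, True), (False, True),
     (True, True), (False, True), (True, True), (False, True), (True, True), (False, True),
     (True, True), (False, True), (True, True), (True, False), (False, True)]"

text \<open>With i and j the floors of 9r/k and 8r/k for the remainder r, one has j < 8 and i = j or
  i = j + 1; all such pairs are the start or a tested point of the path.\<close>

lemma unit_path_bounded: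
  assumes "bounded_on_path b f unit_path (9 * m) (8 * m)" and "f (9 * m) (8 * m) \<le> b"
    and "m = n div k" and "k > 0"
  shows "f (9 * n div k) (8 * n div k) \<le> b"
proof -
  define r where "r = n mod k"
  have n: "n = k * m + r" by (simp add: assms(3) r_def)
  have r: "r < k" using assms(4) by (simp add: r_def)
  define i j where "i = 9 * r div k" and "j = 8 * r div k"
  have st: "9 * n div k = 9 * m + i" "8 * n div k = 8 * m + j"
  proof -
    have "9 * n div k = (9 * r + k * (9 * m)) div k" "8 * n div k = (8 * r + k * (8 * m)) div k"
      by (simp_all add: n algebra_simps)
    thus "9 * n div k = 9 * m + i" "8 * n div k = 8 * m + j"
      using assms(4) by (simp_all only: i_def j_def div_mult_self2)
  qed
  have "k * i \<le> 9 * r" "k * j \<le> 8 * r"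
    unfolding i_def j_def by simp_all
  moreover have "9 * r < k * (i + 1)" "8 * r < k * (j + 1)"
    using dividend_less_times_div[OF assms(4), of "9 * r"] dividend_less_times_div[OF assms(4), of "8 * r"]
    by (simp_all add: i_def j_def)
  \<comment> \<open>The last two inequalities compare the two floors through the common quantity 72
    r.\<close>
  ultimately have "k * i < k * 9" "k * (9 * j) < k * (8 * (i + 1))" "k * (8 * i) < k * (9 * (j + 1))"
    using r unfolding mult.left_commute[of k 9] mult.left_commute[of k 8] by linarith+
  hence ij: "i < 9" "9 * j < 8 * (i + 1)" "8 * i < 9 * (j + 1)"
    using assms(4) by (simp_all only: mult_less_cancel1)
  define s t where "s = 9 * m" and "t = 8 * m"
  have path: "bounded_on_path b f unit_path s t" and "f s t \<le> b"
    using assms(1,2) by (simp_all add: s_def t_def)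
  have "j \<le> i" "i \<le> Suc j" "j < 8"
    using ij by simp_all
  consider "j = 0" | "j = 1" | "j = 2" | "j = 3" | "j = 4" | "j = 5" | "j = 6" | "j = 7"
    using \<open>j < 8\<close> by linarith
  hence "f (s + j) (t + j) \<le> b \<and> f (s + Suc j) (t + j) \<le> b"
    using path \<open>f s t \<le> b\<close> by cases (simp_all add: unit_path_def numeral_eq_Suc)
  moreover have "i = j \<or> i = Suc j" using \<open>j \<le> i\<close> \<open>i \<le> Suc j\<close> by linarith
  ultimately have "f (s + i) (t + j) \<le> b" by blast
  thus ?thesis by (simp add: st s_def t_def)
qed

fun walk_units where
  "walk_units b 0 xs ys v = Some (v, xs, ys)"
| "walk_units b (Suc n) xs ys v =
    (case walk b unit_path xs ys v of
       None \<Rightarrow> None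
     | Some (v', xs', ys') \<Rightarrow> walk_units b n xs' ys' v')"

lemma walk_units_numeral:
  "walk_units b (numeral n) xs ys v =
    (case walk b unit_path xs ys v of
       None \<Rightarrow> None
     | Some (v', xs', ys') \<Rightarrow> walk_units b (pred_numeral n) xs' ys' v')"
  by (simp add: numeral_eq_Suc)

lemma walk_units_1: "walk_units b 1 xs ys v = walk b unit_path xs ys v"
  by (simp split: option.split)

text \<open>Induction over the l unit intervals from m to m + l: either n/k lies in the first one,
  or the argument restarts at its right end.\<close>

lemma walk_units_bounded:
  assumes pos: "\<forall>(c, d) \<in> set cs. d > 0" "\<forall>(c, d) \<in> set ds. d > 0"
  defines "f \<equiv> \<lambda>s t. floor_comb cs s + floor_comb ds t"
  assumes "walk_units b l (counters cs (9 * m)) (counters ds (8 * m)) (f (9 * m) (8 * m)) \<noteq> None"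
    and "f (9 * m) (8 * m) \<le> b"
    and "n div k \<ge> m" "n div k < m + l" "k > 0"
  shows "f (9 * n div k) (8 * n div k) \<le> b"
  using assms(4-)
proof (induction l arbitrary: m)
  case (Suc l)
  from Suc.prems(1) obtain v xs ys
    where walk: "walk b unit_path (counters cs (9 * m)) (counters ds (8 * m)) (f (9 * m) (8 * m)) = Some (v, xs, ys)"
      and rest: "walk_units b l xs ys v \<noteq> None"
    by (auto split: option.splits)
  have len: "length (filter fst unit_path) = 9" "length (filter (\<lambda>p. \<not>fst p) unit_path) = 8"
    by (simp_all add: unit_path_def)
  have path: "bounded_on_path b f unit_path (9 * m) (8 * m)"
    and state: "v = f (9 * Suc m) (8 * Suc m)" "xs = counters cs (9 * Suc m)" "ys = counters ds (8 * Suc m)"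
    using walk_counters[OF pos walk[unfolded f_def]] by (simp_all add: f_def len add_ac)
  show ?case
  proof (cases "n div k = m")
    case True
    thus ?thesis using unit_path_bounded[OF path Suc.prems(2)] Suc.prems(5) by simp
  next
    case False
    \<comment> \<open>The last step of the path is tested, which supplies the starting bound for the
      next unit.\<close>
    have "f (s + 9) (t + 8) \<le> b" if "bounded_on_path b f unit_path s t" for s t
      using that by (simp add: unit_path_def numeral_eq_Suc)
    from this[OF path] have "f (9 * Suc m) (8 * Suc m) \<le> b"
      by (simp add: add.commute)
    with False Suc.prems rest state show ?thesis by (intro Suc.IH[of "Suc m"]) auto
  qed
qed auto

subsection \<open>The combination for the interval from 8n to 9n\<close>

text \<open>
  The fraction 9/d has the coefficient paired with d in \<open>weights9\<close>, and 8/d the one in \<open>weights8\<close>. The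
  first entries are those of a truncated Moebius inversion of \<psi>(9n) - \<psi>(8n); the later ones were found
  by linear programming and adjusted so that the balance condition holds exactly.
\<close>

definition weights9 :: "(int \<times> nat) list" where
  "weights9 = [(1, 1), (-1, 2), (-1, 3), (-1, 5), (1, 6), (-1, 7), (1, 10), (1, 14), (-1, 18),
    (1, 21), (1, 45), (1, 63), (1, 810)]"

definition weights8 :: "(int \<times> nat) list" where
  "weights8 = [(-1, 1), (1, 2), (1, 3), (1, 5), (-1, 6), (1, 7), (-1, 9), (-1, 10), (-1, 14), (1, 18)]"

lemma weights_pos:
  "\<forall>(c, d) \<in> set weights9. d > 0" "\<forall>(c, d) \<in> set weights8. d > 0"
  by (simp_all add: weights9_def weights8_def)

text \<open>This is G(z) for s = \<lfloor>9z\<rfloor> and t = \<lfloor>8z\<rfloor>: dividing these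
  floors by d gives the floors of 9z/d and 8z/d.\<close>

definition weight_sum :: "nat \<Rightarrow> nat \<Rightarrow> int" where
  "weight_sum s t = floor_comb weights9 s + floor_comb weights8 t"

text \<open>The finite computation behind G(z) \<le> 0 for 1 \<le> z < 35; the next lemma does the
  same for G(z) \<le> 1 on 35 \<le> z < 120.\<close>

lemma walk_units_1_to_35:
  "walk_units 0 34 (counters weights9 (9 * 1)) (counters weights8 (8 * 1)) (weight_sum (9 * 1) (8 * 1)) \<noteq> None"
  by (simp add: counters_def weight_sum_def floor_comb_def weights9_def weights8_def unit_path_def
      walk_units_numeral walk_units_1 del: One_nat_def)

lemma walk_units_35_to_120:
  "walk_units 1 85 (counters weights9 (9 * 35)) (counters weights8 (8 * 35)) (weight_sum (9 * 35) (8 * 35)) \<noteq> None"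
  by (simp add: counters_def weight_sum_def floor_comb_def weights9_def weights8_def unit_path_def
      walk_units_numeral walk_units_1 del: One_nat_def)

lemma weight_sum_initial:
  assumes "n div k = 0" "k > 0"
  shows "weight_sum (9 * n div k) (8 * n div k) \<le> of_bool (8 * n < k)"
proof -
  \<comment> \<open>Subtracting the indicator of t = 0, that is z < 1/8, turns the claim into a
    uniform bound 0. For z < 1/9 the bound 1 is generous but harmless, as only k \<le> 9n occur
    later.\<close>
  define f where "f = (\<lambda>s t. weight_sum s t - of_bool (t = 0))"
  have "bounded_on_path 0 f unit_path (9 * 0) (8 * 0)"
    by (simp add: f_def unit_path_def weight_sum_def floor_comb_def weights9_def weights8_def)
  moreover have "f (9 * 0) (8 * 0) \<le> 0"
    by (simp add: f_def weight_sum_def floor_comb_def weights9_def weights8_def)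
  ultimately have "f (9 * n div k) (8 * n div k) \<le> 0"
    using assms by (intro unit_path_bounded[of 0 f 0]) auto
  moreover have "8 * n div k = 0 \<longleftrightarrow> 8 * n < k" using assms by (simp add: div_eq_0_iff)
  ultimately show ?thesis by (simp add: f_def)
qed

text \<open>The linear parts cancel by balance; each of the ten coefficients equal to -1 costs at
  most 1.\<close>

lemma weight_sum_le_10:
  assumes "k > 0"
  shows "weight_sum (9 * n div k) (8 * n div k) \<le> 10"
proof -
  have "real_of_int (weight_sum (9 * n div k) (8 * n div k)) \<le> 10"
    using floor_comb_div_le[OF assms weights_pos(1), of "9 * n"] floor_comb_div_le[OF assms weights_pos(2), of "8 * n"]
    by (simp add: weight_sum_def weights9_def weights8_def field_simps)
  thus ?thesis by linarith
qed

text \<open>The weight 9 completes the bound 10: for n/k \<ge> 120 the indicator for 35 is 1 as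
  well.\<close>

lemma weight_sum_le:
  assumes "k > 0"
  shows "weight_sum (9 * n div k) (8 * n div k)
           \<le> of_bool (8 * n < k) + of_bool (k \<le> n div 35) + 9 * of_bool (k \<le> n div 120)"
proof -
  have swap: "k \<le> n div m \<longleftrightarrow> m \<le> n div k" if "m > 0" for m
    using assms that by (simp add: less_eq_div_iff_mult_less_eq mult.commute)
  have "weight_sum (9 * 1) (8 * 1) \<le> 0" "weight_sum (9 * 35) (8 * 35) \<le> 1"
    by (simp_all add: weight_sum_def floor_comb_def weights9_def weights8_def del: One_nat_def)
  note walks =
    walk_units_bounded[OF weights_pos, folded weight_sum_def, OF walk_units_1_to_35 this(1)]
    walk_units_bounded[OF weights_pos, folded weight_sum_def, OF walk_units_35_to_120 this(2)]
  consider "n div k = 0" | "1 \<le> n div k" "n div k < 35" | "35 \<le> n div k" "n div k < 120" | "n div k \<ge> 120"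
    by linarith
  thus ?thesis
  proof cases
    case 1
    thus ?thesis using weight_sum_initial[OF 1 assms] by (simp add: swap)
  next
    case 2
    hence "weight_sum (9 * n div k) (8 * n div k) \<le> 0" using walks(1)[of n k] assms by simp
    also have "0 \<le> of_bool (8 * n < k) + of_bool (k \<le> n div 35) + 9 * (of_bool (k \<le> n div 120) :: int)"
      by simp
    finally show ?thesis .
  next
    case 3
    hence "weight_sum (9 * n div k) (8 * n div k) \<le> 1" using walks(2)[of n k] assms by simp
    also have "1 \<le> of_bool (8 * n < k) + of_bool (k \<le> n div 35) + 9 * (of_bool (k \<le> n div 120) :: int)"
      using 3 by (simp add: swap)
    finally show ?thesis .
  next
    case 4
    have "weight_sum (9 * n div k) (8 * n div k) \<le> 10" using assms by (rule weight_sum_le_10)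
    also have "10 \<le> of_bool (8 * n < k) + of_bool (k \<le> n div 35) + 9 * (of_bool (k \<le> n div 120) :: int)"
      using 4 by (simp add: swap)
    finally show ?thesis .
  qed
qed

text \<open>The constant is 29/280 = 1/35 + 9/120, from psi(x) \<le> x ln 4 at n/35 and
  n/120.\<close>

lemma ln_fact_combs_le:
  "ln_fact_comb weights9 (9 * n) + ln_fact_comb weights8 (8 * n)
     \<le> chebyshev_psi (9 * n) - chebyshev_psi (8 * n) + ln 4 * (29 / 280) * n"
proof -
  have "ln_fact_comb weights9 (9 * n) + ln_fact_comb weights8 (8 * n)
      = (\<Sum>k = 1..9 * n. mangoldt k * of_int (weight_sum (9 * n div k) (8 * n div k)))"
    by (simp add: ln_fact_comb_eq_sum_mangoldt[of _ "9 * n"] weight_sum_def distrib_left flip: sum.distrib)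
  also have "\<dots> \<le> (\<Sum>k = 1..9 * n. mangoldt k * of_int
      (of_bool (8 * n < k) + of_bool (k \<le> n div 35) + 9 * of_bool (k \<le> n div 120)))"
  proof (intro sum_mono mult_left_mono mangoldt_nonneg)
    fix k assume "k \<in> {1..9 * n}"
    thus "of_int (weight_sum (9 * n div k) (8 * n div k)) \<le> (of_int
        (of_bool (8 * n < k) + of_bool (k \<le> n div 35) + 9 * of_bool (k \<le> n div 120)) :: real)"
      unfolding of_int_le_iff by (intro weight_sum_le) auto
  qed
  also have "\<dots> = (\<Sum>k = 1..9 * n. mangoldt k - mangoldt k * of_bool (k \<le> 8 * n)
      + mangoldt k * of_bool (k \<le> n div 35) + 9 * (mangoldt k * of_bool (k \<le> n div 120)))"
    by (intro sum.cong) (auto simp: not_less)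
  also have "\<dots> = chebyshev_psi (9 * n) - chebyshev_psi (8 * n)
      + chebyshev_psi (n div 35) + 9 * chebyshev_psi (n div 120)"
  proof -
    have "n div 35 \<le> 9 * n" "n div 120 \<le> 9 * n" by linarith+
    thus ?thesis
      unfolding sum.distrib sum_subtractf sum_distrib_left[symmetric]
      by (subst (1 2 3) chebyshev_psi_restrict) (simp_all add: chebyshev_psi_def)
  qed
  also have "chebyshev_psi (n div 35) \<le> n / 35 * ln 4"
    using chebyshev_psi_div_le[of n 35] by simp
  also have "chebyshev_psi (n div 120) \<le> n / 120 * ln 4"
    using chebyshev_psi_div_le[of n 120] by simp
  finally show ?thesis by (simp add: field_simps)
qed

lemma ln_fact_combs_limit_gt:
  "ln 4 * (29 / 280) < (\<Sum>(c, d)\<leftarrow>weights9. of_int c * (real 9 / d * ln (real 9 / d)))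
      + (\<Sum>(c, d)\<leftarrow>weights8. of_int c * (real 8 / d * ln (real 8 / d)))"
proof -
  have "ln (real d) = ln (real a) + ln (real b)" if "d = a * b" "a > 0" "b > 0" for a b d :: nat
    using that by (simp add: ln_mult)
  note split = this[of 4 2 2] this[of 6 2 3] this[of 8 2 4] this[of 9 3 3] this[of 10 2 5]
    this[of 14 2 7] this[of 18 2 9] this[of 21 3 7] this[of 45 5 9] this[of 63 7 9] this[of 810 9 90] this[of 90 9 10]
  \<comment> \<open>After splitting into logs of 2, 3, 5 and 7, the coefficient of ln 3 in the limit
    is positive and those of ln 5 and ln 7 are negative. So 2^19 < 3^12, 5^3 < 2^7 and 7^6 < 2^17
    reduce the claim to ln 2 > 0.\<close>
  have "19 * ln 2 = ln (2 ^ 19 :: real)" "12 * ln 3 = ln (3 ^ 12 :: real)"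
    "3 * ln 5 = ln (5 ^ 3 :: real)" "7 * ln 2 = ln (2 ^ 7 :: real)"
    "6 * ln 7 = ln (7 ^ 6 :: real)" "17 * ln 2 = ln (2 ^ 17 :: real)"
    by (simp_all only: ln_realpow of_nat_numeral zero_less_numeral)
  hence "19 * ln 2 < 12 * ln (3 :: real)" "3 * ln 5 < 7 * ln (2 :: real)" "6 * ln 7 < 17 * ln (2 :: real)"
    by simp_all
  moreover have "ln (2 :: real) > 0" by simp
  ultimately show ?thesis
    using split by (simp add: weights9_def weights8_def ln_div add_divide_distrib diff_divide_distrib algebra_simps)
      (use \<open>ln (2 :: real) > 0\<close> in linarith)
qed

section \<open>Linear growth of psi(9n) - psi(8n) and the resulting prime count\<close>

theorem theorem4p0p4:
  shows "filterlim (\<lambda>n::nat. card {p::nat. prime p \<and> p \<in> {8 * n..9 * n}}) at_top sequentially \<and>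
    (\<forall>m::nat. m > 0 \<longrightarrow> (\<exists>L::nat. L > 0 \<and>
       (\<forall>n\<ge>L. card {p::nat. prime p \<and> p \<in> {8 * n..9 * n}} \<ge> m)))"
proof
  define C where "C = (\<lambda>n::nat. card {p::nat. prime p \<and> p \<in> {8 * n..9 * n}})"
  define \<kappa> :: real where "\<kappa> = ln 4 * (29 / 280)"
  define A where "A = (\<Sum>(c, d)\<leftarrow>weights9. of_int c * (real 9 / d * ln (real 9 / d)))
      + (\<Sum>(c, d)\<leftarrow>weights8. of_int c * (real 8 / d * ln (real 8 / d)))"
  define L where "L = (\<lambda>n. ln_fact_comb weights9 (9 * n) + ln_fact_comb weights8 (8 * n))"
  \<comment> \<open>The sum of c(q) q vanishes, which removes the n ln n and n terms of Stirling's
    formula.\<close>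
  have balance: "(\<Sum>(c, d)\<leftarrow>weights9. of_int c / real d) * real 9
      = - ((\<Sum>(c, d)\<leftarrow>weights8. of_int c / real d) * real 8)"
    by (simp add: weights9_def weights8_def)
  have "(\<lambda>n. L n / n) \<longlonglongrightarrow> A"
    using tendsto_add[OF ln_fact_comb_asymp[OF _ weights_pos(1), of 9] ln_fact_comb_asymp[OF _ weights_pos(2), of 8]]
    unfolding balance by (simp add: A_def L_def add_divide_distrib algebra_simps)
  moreover obtain \<delta> where \<delta>: "\<delta> > 0" "\<kappa> + \<delta> < A"
  proof
    show "(A - \<kappa>) / 2 > 0" "\<kappa> + (A - \<kappa>) / 2 < A"
      using ln_fact_combs_limit_gt by (simp_all add: A_def \<kappa>_def field_simps)
  qed
  ultimately have "\<forall>\<^sub>F n in sequentially. L n / n > \<kappa> + \<delta>"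
    by (simp add: order_tendsto_iff)
  \<comment> \<open>Eventually psi(9n) - psi(8n) \<ge> \<delta> n; dividing by ln (9n) and removing
    the proper prime powers leaves a lower bound for the number of primes.\<close>
  hence "\<forall>\<^sub>F n in sequentially.
      \<delta> * n / ln (9 * real n) - (sqrt (9 * real n) + 1) * (log 2 (9 * real n) + 1) \<le> real (C n)"
    using eventually_gt_at_top[of 0]
  proof eventually_elim
    case (elim n)
    have "(\<kappa> + \<delta>) * n \<le> L n" using elim by (simp add: field_simps)
    moreover have "L n \<le> chebyshev_psi (9 * n) - chebyshev_psi (8 * n) + \<kappa> * n"
      unfolding L_def \<kappa>_def by (rule ln_fact_combs_le)
    moreover have "chebyshev_psi (9 * n) - chebyshev_psi (8 * n)
        \<le> (real (C n) + (sqrt (9 * real n) + 1) * (log 2 (9 * real n) + 1)) * ln (9 * real n)"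
      using chebyshev_psi_diff_le_card_primes[of "8 * n" "9 * n"] elim by (simp add: C_def)
    ultimately have "\<delta> * n \<le> (real (C n) + (sqrt (9 * real n) + 1) * (log 2 (9 * real n) + 1)) * ln (9 * real n)"
      by (simp add: distrib_right)
    moreover have "ln (9 * real n) > 0" using elim by (intro ln_gt_zero) linarith
    ultimately have "\<delta> * n / ln (9 * real n)
        \<le> real (C n) + (sqrt (9 * real n) + 1) * (log 2 (9 * real n) + 1)"
      by (simp add: pos_divide_le_eq)
    thus ?case by linarith
  qed
  \<comment> \<open>The main term n / ln n dominates sqrt n * ln n.\<close>
  moreover have "filterlim (\<lambda>n. \<delta> * n / ln (9 * real n) - (sqrt (9 * real n) + 1) * (log 2 (9 * real n) + 1))
      at_top sequentially"
    using \<delta>(1) unfolding log_def by real_asymp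
  ultimately have "filterlim (\<lambda>n. real (C n)) at_top sequentially"
    by (rule filterlim_at_top_mono[rotated])
  thus lim: "filterlim C at_top sequentially"
    by (simp add: filterlim_sequentially_iff_filterlim_real)
  show "\<forall>m::nat. m > 0 \<longrightarrow> (\<exists>L::nat. L > 0 \<and> (\<forall>n\<ge>L. C n \<ge> m))"
  proof (intro allI impI)
    fix m :: nat
    have "\<forall>\<^sub>F n in sequentially. C n \<ge> m" using lim by (simp add: filterlim_at_top)
    then obtain N where "\<And>n. n \<ge> N \<Longrightarrow> C n \<ge> m" by (auto simp: eventually_sequentially)
    thus "\<exists>L::nat. L > 0 \<and> (\<forall>n\<ge>L. C n \<ge> m)" by (intro exI[of _ "Suc N"]) auto
  qed
qed

end
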